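(* Let $\kappa > \omega$ be a regular cardinal. If $\mathfrak{b}(\kappa) = \kappa^{+}$, then $\mathfrak{a}(\kappa) = \kappa^{+}$.
   Context: For $f, g \in \kappa^\kappa$, $f \leq^* g$ means $|\{\alpha<\kappa : g(\alpha) < f(\alpha)\}| < \kappa$. A family $F \subseteq \kappa^\kappa$ is unbounded if there is no $g \in \kappa^\kappa$ with $f \leq^* g$ for all $f \in F$; $\mathfrak{b}(\kappa)$ is the least size of an unbounded family. Sets $A, B \in [\kappa]^\kappa$ are almost disjoint if $|A \cap B| < \kappa$; a family $\mathscr{A} \subseteq [\kappa]^\kappa$ is maximal almost disjoint (m.a.d.) if its members are pairwise almost disjoint, $|\mathscr{A}| \geq \kappa$, and no $B \in [\kappa]^\kappa$ is almost disjoint from every member of $\mathscr{A}$ (i.e. $\mathscr{A}$ cannot be extended to a larger almost disjoint family in $[\kappa]^\kappa$). $\mathfrak{a}(\kappa)$ is the least size of a m.a.d. family in $[\kappa]^\kappa$. *)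

theory Defs
  imports Main "HOL-Library.FuncSet"
begin

unbundle cardinal_syntax

text \<open>The cardinal kappa is represented by a cardinal order r (a well-order on Field r
  of order type the initial ordinal kappa). The strict order on kappa is
  (a,b) \<in> r \<and> a \<noteq> b.\<close>

definition kfun :: "'a rel \<Rightarrow> ('a \<Rightarrow> 'a) set" where
  "kfun r = Field r \<rightarrow>\<^sub>E Field r"

definition leq_star :: "'a rel \<Rightarrow> ('a \<Rightarrow> 'a) \<Rightarrow> ('a \<Rightarrow> 'a) \<Rightarrow> bool" where
  "leq_star r f g \<longleftrightarrow> |{\<alpha> \<in> Field r. (g \<alpha>, f \<alpha>) \<in> r \<and> g \<alpha> \<noteq> f \<alpha>}| <o r"

definition unbounded_family :: "'a rel \<Rightarrow> ('a \<Rightarrow> 'a) set \<Rightarrow> bool" where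
  "unbounded_family r F \<longleftrightarrow> F \<subseteq> kfun r \<and> \<not> (\<exists>g \<in> kfun r. \<forall>f \<in> F. leq_star r f g)"

definition bounding_number_is :: "'a rel \<Rightarrow> 'b rel \<Rightarrow> bool" where
  "bounding_number_is r c \<longleftrightarrow>
     (\<exists>F. unbounded_family r F \<and> |F| =o c) \<and> (\<forall>F. unbounded_family r F \<longrightarrow> c \<le>o |F| )"

definition kappa_subsets :: "'a rel \<Rightarrow> 'a set set" where
  "kappa_subsets r = {A. A \<subseteq> Field r \<and> |A| =o r}"

definition almost_disjoint :: "'a rel \<Rightarrow> 'a set \<Rightarrow> 'a set \<Rightarrow> bool" where
  "almost_disjoint r A B \<longleftrightarrow> |A \<inter> B| <o r"

definition mad_family :: "'a rel \<Rightarrow> 'a set set \<Rightarrow> bool" where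
  "mad_family r \<A> \<longleftrightarrow>
     \<A> \<subseteq> kappa_subsets r \<and>
     (\<forall>A \<in> \<A>. \<forall>B \<in> \<A>. A \<noteq> B \<longrightarrow> almost_disjoint r A B) \<and>
     r \<le>o |\<A>| \<and>
     \<not> (\<exists>B \<in> kappa_subsets r. \<forall>A \<in> \<A>. almost_disjoint r B A)"

definition almost_disjointness_number_is :: "'a rel \<Rightarrow> 'b rel \<Rightarrow> bool" where
  "almost_disjointness_number_is r c \<longleftrightarrow>
     (\<exists>\<A>. mad_family r \<A> \<and> |\<A>| =o c) \<and> (\<forall>\<A>. mad_family r \<A> \<longrightarrow> c \<le>o |\<A>| )"

end

theory Submission
  imports Defs
begin

text \<open>The unbounded family can be replaced by a family of functions \<open>\<Phi>\<^sub>x\<close> unbounded modulo the club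
  filter (Cummings and Shelah): if every such family were bounded, iterating \<open>\<omega>\<close> times the passage
  from clubs to their successor functions would, by well-foundedness, give a single bound for the
  gaps of all the clubs involved, and hence for the original family.  Start from a partition of
  \<open>\<kappa>\<close> into \<open>\<kappa>\<close> sets of size \<open>\<kappa>\<close>, and let \<open>T\<^sub>x\<close> be the union over \<open>a < \<kappa>\<close> of the intervals
  \<open>[a, \<Phi>\<^sub>x(a))\<close>, minus the first \<open>a\<close> sets of an enumeration in type \<open>\<kappa>\<close> of all earlier sets.
  If \<open>B\<close> were almost disjoint from all these sets, choose \<open>x\<close> such that stationarily many intervals
  \<open>[a, \<Phi>\<^sub>x(a))\<close> contain an element of \<open>B\<close> above \<open>a\<close>; off \<open>T\<^sub>x\<close> this element lies in one of the first \<open>a\<close> sets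
  of the enumeration, which pressing down refutes.\<close>

section \<open>The well-order on \<kappa>, small sets and regularity\<close>

locale regular_uncountable =
  fixes r :: "'a rel"
  assumes card: "Card_order r"
    and uncountable: "natLeq <o r"
    and regular: "regularCard r"
begin

abbreviation K :: "'a set" where "K \<equiv> Field r"

abbreviation le :: "'a \<Rightarrow> 'a \<Rightarrow> bool" (infix "\<preceq>" 50) where
  "a \<preceq> b \<equiv> (a, b) \<in> r"

definition lt :: "'a \<Rightarrow> 'a \<Rightarrow> bool" (infix "\<prec>" 50) where
  "a \<prec> b \<longleftrightarrow> a \<preceq> b \<and> a \<noteq> b"

lemma small_finite: "finite A \<Longrightarrow> |A| <o r"
  using finite_iff_ordLess_natLeq ordLess_transitive uncountable by blast

lemma infinite_K: "infinite K"
proof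
  assume "finite K"
  then have "|K| <o r"
    by (rule small_finite)
  then show False
    using card_of_Field_ordIso[OF card] not_ordLess_ordIso by blast
qed

lemma card_K: "|K| =o r"
  using card by (rule card_of_Field_ordIso)

lemma Well: "Well_order r"
  using card by (simp add: card_order_on_def)

lemma wo: "wo_rel r"
  using Well by (simp add: wo_rel_def)

lemma le_trans: "a \<preceq> b \<Longrightarrow> b \<preceq> c \<Longrightarrow> a \<preceq> c"
  using wo_rel.TRANS[OF wo] by (meson transD)

lemma le_antisym: "a \<preceq> b \<Longrightarrow> b \<preceq> a \<Longrightarrow> a = b"
  using wo_rel.ANTISYM[OF wo] by (meson antisymD)

lemma le_refl: "a \<in> K \<Longrightarrow> a \<preceq> a"
  using wo_rel.REFL[OF wo] by (meson refl_onD)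

lemma le_K: "a \<preceq> b \<Longrightarrow> a \<in> K \<and> b \<in> K"
  by (auto simp: Field_def)

lemma lt_K: "a \<prec> b \<Longrightarrow> a \<in> K \<and> b \<in> K"
  by (auto simp: lt_def le_K)

lemma not_le: "a \<in> K \<Longrightarrow> b \<in> K \<Longrightarrow> \<not> a \<preceq> b \<longleftrightarrow> b \<prec> a"
  using wo_rel.TOTALS[OF wo] le_antisym le_refl by (auto simp: lt_def)

lemma not_lt: "a \<in> K \<Longrightarrow> b \<in> K \<Longrightarrow> \<not> a \<prec> b \<longleftrightarrow> b \<preceq> a"
  using not_le by blast

lemma lt_imp_le: "a \<prec> b \<Longrightarrow> a \<preceq> b"
  by (simp add: lt_def)

lemma le_lt_trans: "a \<preceq> b \<Longrightarrow> b \<prec> c \<Longrightarrow> a \<prec> c"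
  using le_trans le_antisym by (auto simp: lt_def)

lemma lt_le_trans: "a \<prec> b \<Longrightarrow> b \<preceq> c \<Longrightarrow> a \<prec> c"
  using le_trans le_antisym by (auto simp: lt_def)

lemma lt_trans: "a \<prec> b \<Longrightarrow> b \<prec> c \<Longrightarrow> a \<prec> c"
  using le_lt_trans lt_imp_le by blast

lemma lt_irrefl: "\<not> a \<prec> a"
  by (simp add: lt_def)

lemma lt_asym: "a \<prec> b \<Longrightarrow> \<not> b \<prec> a"
  using le_antisym by (auto simp: lt_def)

lemma lt_wf: "wf {(a, b). a \<prec> b}"
proof -
  have "{(a, b). a \<prec> b} = r - Id"
    by (auto simp: lt_def)
  then show ?thesis
    using wo_rel.WF[OF wo] by simp
qed

lemma lt_minimal:
  assumes "x \<in> S" "S \<subseteq> K"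
  obtains m where "m \<in> S" "\<And>y. y \<in> S \<Longrightarrow> m \<preceq> y"
proof -
  obtain m where "m \<in> S" "\<And>y. y \<prec> m \<Longrightarrow> y \<notin> S"
    using wfE_min[OF lt_wf assms(1)] by auto
  then show ?thesis
    using that assms(2) not_le by blast
qed

lemma small_subset: "|B| <o r \<Longrightarrow> A \<subseteq> B \<Longrightarrow> |A| <o r"
  using card_of_mono1 ordLeq_ordLess_trans by blast

text \<open>Contraposition of regularity: \<open>regularCard\<close> gives every cofinal subset size
  \<kappa>, so a small set is not cofinal.\<close>

lemma small_bounded:
  assumes "A \<subseteq> K" "|A| <o r"
  obtains b where "b \<in> K" "\<And>a. a \<in> A \<Longrightarrow> a \<preceq> b"
proof -
  have "\<not> cofinal A r"
    using assms regular unfolding regularCard_def using not_ordLess_ordIso by blast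
  then obtain b where "b \<in> K" "\<And>a. a \<in> A \<Longrightarrow> \<not> b \<prec> a"
    by (auto simp: cofinal_def lt_def)
  then show ?thesis
    using that assms(1) not_lt by blast
qed

lemma small_UN:
  assumes "|I| <o r" "\<And>i. i \<in> I \<Longrightarrow> |S i| <o r"
  shows "|\<Union>i\<in>I. S i| <o r"
  using card_of_UNION_ordLess_infinite_Field[OF regularCard_stable[OF card infinite_K regular]
      card assms(1)] assms(2) by blast

text \<open>Uncountability makes \<omega>-sequences small, and regularity then bounds them in
  \<kappa>. The constructions in \<omega> steps rest on this.\<close>

lemma small_countable: "|range (f :: nat \<Rightarrow> 'b)| <o r"
  using card_of_image[of f UNIV] card_of_nat uncountable
  by (blast intro: ordLeq_ordLess_trans ordIso_ordLess_trans)

lemma small_below: "|{a. a \<prec> b}| <o r"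
proof (cases "b \<in> K")
  case True
  have "{a. a \<prec> b} = underS r b"
    by (auto simp: underS_def lt_def)
  then show ?thesis
    using card_of_underS[OF card True] by simp
next
  case False
  then have "{a. a \<prec> b} = {}"
    using lt_K by blast
  then show ?thesis
    by (simp add: small_finite)
qed

lemma ex_greater:
  assumes "a \<in> K"
  obtains b where "a \<prec> b"
  using infinite_Card_order_limit[OF card infinite_K assms] that by (auto simp: lt_def)

lemma small_below_eq: "|{a. a \<preceq> b}| <o r"
proof (cases "b \<in> K")
  case True
  then obtain c where "b \<prec> c"
    using ex_greater by blast
  then have "{a. a \<preceq> b} \<subseteq> {a. a \<prec> c}"
    using le_lt_trans by auto
  then show ?thesis
    using small_below small_subset by blast
next
  case False
  then have "{a. a \<preceq> b} \<subseteq> {a. a \<prec> b}"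
    using le_K by blast
  then show ?thesis
    using small_below small_subset by blast
qed

lemma small_bounded_lt:
  assumes "A \<subseteq> K" "|A| <o r"
  obtains b where "b \<in> K" "\<And>a. a \<in> A \<Longrightarrow> a \<prec> b"
proof -
  obtain b where "b \<in> K" "\<And>a. a \<in> A \<Longrightarrow> a \<preceq> b"
    using small_bounded assms by blast
  moreover obtain c where "b \<prec> c"
    using ex_greater calculation(1) by blast
  ultimately show ?thesis
    using that le_lt_trans lt_K by blast
qed

lemma large_unbounded:
  assumes "A \<subseteq> K" "\<not> |A| <o r" "a \<in> K"
  obtains b where "b \<in> A" "a \<prec> b"
proof -
  have "\<not> A \<subseteq> {b. b \<preceq> a}"
    using assms small_below_eq small_subset by blast
  then show ?thesis
    using that assms not_le by blast
qed

section \<open>Clubs of closure points\<close>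

text \<open>Clubs enter only through the sets of nonzero closure points of a function: every club contains one.\<close>

definition closure_points :: "('a \<Rightarrow> 'a) \<Rightarrow> 'a set" where
  "closure_points f = {a. (\<exists>b. b \<prec> a) \<and> (\<forall>b. b \<prec> a \<longrightarrow> f b \<prec> a)}"

lemma closure_points_K: "closure_points f \<subseteq> K"
  using lt_K by (auto simp: closure_points_def)

text \<open>Lets a pointwise upper bound of several functions stand for a club inside the
  intersection of their clubs.\<close>

lemma closure_points_antimono:
  assumes "\<And>a. a \<in> K \<Longrightarrow> f a \<preceq> g a"
  shows "closure_points g \<subseteq> closure_points f"
  using assms le_lt_trans lt_K unfolding closure_points_def by blast

lemma countable_sup:
  assumes "\<And>n :: nat. f n \<in> K \<rightarrow> K"
  obtains g where "g \<in> K \<rightarrow> K" "\<And>n a. a \<in> K \<Longrightarrow> f n a \<preceq> g a"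
proof -
  have "\<exists>b \<in> K. \<forall>n. f n a \<preceq> b" if "a \<in> K" for a
  proof -
    have "range (\<lambda>n. f n a) \<subseteq> K"
      using assms that by blast
    from small_bounded[OF this small_countable]
    obtain b where "b \<in> K" "\<And>c. c \<in> range (\<lambda>n. f n a) \<Longrightarrow> c \<preceq> b"
      by blast
    then show ?thesis
      by blast
  qed
  then obtain g where "\<forall>a\<in>K. g a \<in> K \<and> (\<forall>n. f n a \<preceq> g a)"
    by metis
  then show ?thesis
    using that by blast
qed

text \<open>The initial segment up to \<open>a\<close> is small, so its image under \<open>f\<close>
  is small and hence bounded.\<close>

lemma running_sup:
  assumes "f \<in> K \<rightarrow> K"
  obtains g where "g \<in> K \<rightarrow> K" "\<And>a b. b \<preceq> a \<Longrightarrow> f b \<preceq> g a"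
proof -
  have "\<exists>c \<in> K. \<forall>b. b \<preceq> a \<longrightarrow> f b \<preceq> c" if "a \<in> K" for a
  proof -
    have "f ` {b. b \<preceq> a} \<subseteq> K"
      using assms le_K by blast
    moreover have "|f ` {b. b \<preceq> a}| <o r"
      using small_below_eq card_of_image ordLeq_ordLess_trans by blast
    ultimately obtain c where "c \<in> K" "\<And>d. d \<in> f ` {b. b \<preceq> a} \<Longrightarrow> d \<preceq> c"
      using small_bounded[of "f ` {b. b \<preceq> a}"] by blast
    then show ?thesis
      by blast
  qed
  then obtain g where "\<forall>a\<in>K. g a \<in> K \<and> (\<forall>b. b \<preceq> a \<longrightarrow> f b \<preceq> g a)"
    by metis
  then show ?thesis
    using that le_K by blast
qed

lemma max_fun:
  assumes "f \<in> K \<rightarrow> K" "g \<in> K \<rightarrow> K"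
  obtains h where "h \<in> K \<rightarrow> K" "\<And>a. a \<in> K \<Longrightarrow> f a \<preceq> h a" "\<And>a. a \<in> K \<Longrightarrow> g a \<preceq> h a"
proof -
  have "(if n = 0 then f else g) \<in> K \<rightarrow> K" for n :: nat
    using assms by simp
  then obtain h where h: "h \<in> K \<rightarrow> K" "\<And>(n :: nat) a. a \<in> K \<Longrightarrow> (if n = 0 then f else g) a \<preceq> h a"
    using countable_sup[of "\<lambda>n. if n = 0 then f else g"] by blast
  show ?thesis
    using that[of h] h(1) h(2)[of _ 0] h(2)[of _ 1] by simp
qed

text \<open>Iterate from \<open>a\<close> a function \<open>h\<close> whose value at
  \<open>c\<close> exceeds \<open>c\<close> and all values of \<open>f\<close> up to
  \<open>c\<close>. The supremum of the \<omega> iterates is closed under \<open>f\<close>.\<close>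

lemma closure_points_unbounded:
  assumes f: "f \<in> K \<rightarrow> K" and a: "a \<in> K"
  obtains c where "c \<in> closure_points f" "a \<prec> c"
proof -
  obtain g where g: "g \<in> K \<rightarrow> K" "\<And>a b. b \<preceq> a \<Longrightarrow> f b \<preceq> g a"
    using running_sup[OF f] by blast
  have "\<exists>d. c \<prec> d \<and> (\<forall>b. b \<preceq> c \<longrightarrow> f b \<prec> d)" if c: "c \<in> K" for c
  proof -
    have "{c, g c} \<subseteq> K" "|{c, g c}| <o r"
      using g c by (blast, simp add: small_finite)
    from small_bounded_lt[OF this]
    obtain d where d: "d \<in> K" "\<And>e. e \<in> {c, g c} \<Longrightarrow> e \<prec> d"
      by blast
    have "c \<prec> d" "g c \<prec> d"
      using d(2) by simp_all
    then show ?thesis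
      using g(2) le_lt_trans by blast
  qed
  then have "\<exists>h. \<forall>c\<in>K. c \<prec> h c \<and> (\<forall>b. b \<preceq> c \<longrightarrow> f b \<prec> h c)"
    by (intro bchoice) blast
  then obtain h where h: "\<And>c. c \<in> K \<Longrightarrow> c \<prec> h c" "\<And>c b. c \<in> K \<Longrightarrow> b \<preceq> c \<Longrightarrow> f b \<prec> h c"
    by blast
  define s where "s n = (h ^^ n) a" for n
  have s_Suc: "s (Suc n) = h (s n)" for n
    by (simp add: s_def)
  have s_K: "s n \<in> K" for n
  proof (induction n)
    case 0
    then show ?case
      by (simp add: s_def a)
  next
    case (Suc n)
    then show ?case
      using h(1) lt_K s_Suc by metis
  qed
  \<comment> \<open>The least element of \<open>B\<close> is the supremum of the iterates. Anything
    below it is at most some \<open>s n\<close>, so \<open>f\<close> sends it below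
    \<open>s (Suc n)\<close>.\<close>
  define B where "B = {c. \<forall>n. s n \<prec> c}"
  have "range s \<subseteq> K"
    using s_K by blast
  from small_bounded_lt[OF this small_countable]
  obtain c0 where "\<And>d. d \<in> range s \<Longrightarrow> d \<prec> c0"
    by blast
  then have "c0 \<in> B"
    by (simp add: B_def)
  moreover have "B \<subseteq> K"
    using lt_K by (auto simp: B_def)
  ultimately obtain c where c: "c \<in> B" "\<And>d. d \<in> B \<Longrightarrow> c \<preceq> d"
    using lt_minimal by blast
  have s_c: "s n \<prec> c" for n
    using c(1) by (simp add: B_def)
  have "f b \<prec> c" if b: "b \<prec> c" for b
  proof -
    have "b \<notin> B"
      using b c(2) le_lt_trans lt_irrefl by blast
    then obtain n where "b \<preceq> s n"
      using not_lt s_K lt_K[OF b] by (auto simp: B_def)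
    then have "f b \<prec> s (Suc n)"
      using h(2) s_K s_Suc by simp
    then show ?thesis
      using s_c lt_trans by blast
  qed
  moreover have "a \<prec> c"
    using s_c[of 0] by (simp add: s_def)
  ultimately show ?thesis
    using that[of c] unfolding closure_points_def by blast
qed

text \<open>Closedness of the club: the supremum \<open>m\<close> of the closure points up to
  \<open>a\<close> is a closure point, as any \<open>b\<close> below \<open>m\<close> lies below
  some closure point \<open>d\<close> with \<open>d \<preceq> m\<close>. The given \<open>c\<close>
  makes \<open>m\<close> nonzero.\<close>

lemma greatest_closure_point_below:
  assumes "c \<in> closure_points f" "c \<preceq> a"
  obtains m where "m \<in> closure_points f" "m \<preceq> a"
    "\<And>d. d \<in> closure_points f \<Longrightarrow> d \<preceq> a \<Longrightarrow> d \<preceq> m"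
proof -
  define D where "D = {d \<in> closure_points f. d \<preceq> a}"
  define U where "U = {u \<in> K. \<forall>d \<in> D. d \<preceq> u}"
  have "a \<in> U"
    using assms(2) le_K by (auto simp: U_def D_def)
  moreover have "U \<subseteq> K"
    by (auto simp: U_def)
  ultimately obtain m where m: "m \<in> U" "\<And>u. u \<in> U \<Longrightarrow> m \<preceq> u"
    using lt_minimal by blast
  have "c \<in> D"
    using assms by (simp add: D_def)
  have "m \<in> closure_points f"
  proof -
    have "f b \<prec> m" if b: "b \<prec> m" for b
    proof -
      have "b \<notin> U"
        using b m(2) le_lt_trans lt_irrefl by blast
      then obtain d where d: "d \<in> D" "\<not> d \<preceq> b"
        using lt_K[OF b] by (auto simp: U_def)
      then have "b \<prec> d"
        using not_le lt_K[OF b] closure_points_K by (auto simp: D_def)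
      then have "f b \<prec> d"
        using d by (simp add: D_def closure_points_def)
      then show ?thesis
        using d m(1) lt_le_trans by (auto simp: U_def)
    qed
    moreover obtain b where "b \<prec> c"
      using assms by (auto simp: closure_points_def)
    then have "b \<prec> m"
      using lt_le_trans m(1) \<open>c \<in> D\<close> by (auto simp: U_def)
    ultimately show ?thesis
      by (auto simp: closure_points_def)
  qed
  then show ?thesis
    using that m \<open>a \<in> U\<close> by (auto simp: U_def D_def)
qed

lemma no_descending: "\<not> (\<forall>n :: nat. s (Suc n) \<prec> s n)"
  using lt_wf unfolding wf_iff_no_infinite_down_chain by auto

section \<open>Unboundedness modulo the club filter\<close>

text \<open>The condition on \<open>x\<close> says that \<open>\<Phi> x\<close> exceeds
  \<open>g\<close> on a stationary set. Indexing by \<open>F\<close> itself keeps the number of new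
  functions under control.\<close>

lemma stationary_family:
  assumes F: "unbounded_family r F"
  shows "\<exists>\<Phi>. (\<forall>x \<in> F. \<Phi> x \<in> K \<rightarrow> K) \<and>
    (\<forall>g \<in> K \<rightarrow> K. \<exists>x\<in>F. \<forall>\<phi> \<in> K \<rightarrow> K. \<exists>a \<in> closure_points \<phi>. g a \<prec> \<Phi> x a)"
proof (rule ccontr)
  assume contra: "\<not> ?thesis"
  \<comment> \<open>The negated claim, read positively: every family indexed by \<open>F\<close> is
    bounded by one \<open>g\<close>, on a club that depends on \<open>x\<close>.\<close>
  have dom: "\<exists>g \<in> K \<rightarrow> K. \<exists>\<phi>. \<forall>x\<in>F. \<phi> x \<in> K \<rightarrow> K \<and> (\<forall>a \<in> closure_points (\<phi> x). \<Phi> x a \<preceq> g a)"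
    if \<Phi>: "\<And>x. x \<in> F \<Longrightarrow> \<Phi> x \<in> K \<rightarrow> K" for \<Phi>
  proof -
    obtain g where g: "g \<in> K \<rightarrow> K"
      "\<And>x. x \<in> F \<Longrightarrow> \<exists>\<phi> \<in> K \<rightarrow> K. \<forall>a \<in> closure_points \<phi>. \<not> g a \<prec> \<Phi> x a"
    proof -
      have "\<not> (\<forall>g \<in> K \<rightarrow> K. \<exists>x\<in>F. \<forall>\<phi> \<in> K \<rightarrow> K. \<exists>a \<in> closure_points \<phi>. g a \<prec> \<Phi> x a)"
        using contra \<Phi> by (metis (no_types))
      then show ?thesis
        using that by (metis (no_types))
    qed
    then obtain \<phi> where \<phi>: "\<And>x. x \<in> F \<Longrightarrow> \<phi> x \<in> K \<rightarrow> K"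
      "\<And>x a. x \<in> F \<Longrightarrow> a \<in> closure_points (\<phi> x) \<Longrightarrow> \<not> g a \<prec> \<Phi> x a"
      by metis
    have "\<Phi> x a \<preceq> g a" if "x \<in> F" "a \<in> closure_points (\<phi> x)" for x a
    proof -
      have "a \<in> K"
        using that(2) closure_points_K by blast
      then have "g a \<in> K" "\<Phi> x a \<in> K"
        using g(1) \<Phi> that(1) by blast+
      then show ?thesis
        using \<phi>(2)[OF that] not_lt by blast
    qed
    then show ?thesis
      using g(1) \<phi>(1) by blast
  qed
  have F_fun: "x \<in> K \<rightarrow> K" if "x \<in> F" for x
    using F that by (auto simp: unbounded_family_def kfun_def)
  have "\<exists>h. h \<in> K \<rightarrow> K \<and> (\<forall>a b. b \<preceq> a \<longrightarrow> x b \<preceq> h a)" if "x \<in> F" for x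
    using running_sup[OF F_fun[OF that]] by metis
  \<comment> \<open>A bound for \<open>H x\<close> at a single point \<open>c\<close> bounds
    \<open>x\<close> everywhere up to \<open>c\<close>, so it suffices to control \<open>H x\<close>
    on a club.\<close>
  then obtain H where H: "\<And>x. x \<in> F \<Longrightarrow> H x \<in> K \<rightarrow> K" "\<And>x a b. x \<in> F \<Longrightarrow> b \<preceq> a \<Longrightarrow> x b \<preceq> H x a"
    by metis
  define P :: "nat \<Rightarrow> (('a \<Rightarrow> 'a) \<Rightarrow> 'a \<Rightarrow> 'a) \<times> ('a \<Rightarrow> 'a) \<Rightarrow> bool" where
    "P = (\<lambda>n (\<phi>, g). g \<in> K \<rightarrow> K \<and> (\<forall>x\<in>F. \<phi> x \<in> K \<rightarrow> K) \<and>
      (n = 0 \<longrightarrow> (\<forall>x\<in>F. \<forall>a \<in> closure_points (\<phi> x). H x a \<preceq> g a)))"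
  \<comment> \<open>One step shrinks every club and supplies a function \<open>g'\<close>, common to
    all \<open>x\<close>, that bounds the gap from a point of the new club to a later point of the
    old one.\<close>
  define Q :: "nat \<Rightarrow> (('a \<Rightarrow> 'a) \<Rightarrow> 'a \<Rightarrow> 'a) \<times> ('a \<Rightarrow> 'a) \<Rightarrow>
      (('a \<Rightarrow> 'a) \<Rightarrow> 'a \<Rightarrow> 'a) \<times> ('a \<Rightarrow> 'a) \<Rightarrow> bool" where
    "Q = (\<lambda>n (\<phi>, g) (\<phi>', g'). \<forall>x\<in>F. closure_points (\<phi>' x) \<subseteq> closure_points (\<phi> x) \<and>
      (\<forall>a \<in> closure_points (\<phi>' x). \<exists>c \<in> closure_points (\<phi> x). a \<prec> c \<and> c \<preceq> g' a))"
  have "\<exists>f. \<forall>n. P n (f n) \<and> Q n (f n) (f (Suc n))"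
  proof (rule dependent_nat_choice)
    show "\<exists>p. P 0 p"
    proof -
      obtain g \<phi> where "g \<in> K \<rightarrow> K"
        "\<forall>x\<in>F. \<phi> x \<in> K \<rightarrow> K \<and> (\<forall>a \<in> closure_points (\<phi> x). H x a \<preceq> g a)"
        using dom[of H] H(1) by blast
      then have "P 0 (\<phi>, g)"
        by (simp add: P_def)
      then show ?thesis ..
    qed
  next
    fix p n
    assume "P n p"
    then obtain \<phi> g where p: "p = (\<phi>, g)" and \<phi>: "\<And>x. x \<in> F \<Longrightarrow> \<phi> x \<in> K \<rightarrow> K"
      unfolding P_def by (cases p) auto
    have "\<exists>c. c \<in> closure_points (\<phi> x) \<and> a \<prec> c" if "x \<in> F" "a \<in> K" for x a
      using closure_points_unbounded[OF \<phi>] that by blast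
    \<comment> \<open>\<open>N x\<close> moves to a later point of the current club. Applying
      \<open>dom\<close> to \<open>N\<close> bounds these jumps uniformly in \<open>x\<close>, on
      new clubs given by \<open>\<psi>\<close>.\<close>
    then obtain N where N: "\<And>x a. x \<in> F \<Longrightarrow> a \<in> K \<Longrightarrow> N x a \<in> closure_points (\<phi> x) \<and> a \<prec> N x a"
      by metis
    then have "N x \<in> K \<rightarrow> K" if "x \<in> F" for x
      using that closure_points_K by blast
    then obtain g' \<psi> where g': "g' \<in> K \<rightarrow> K" and \<psi>: "\<And>x. x \<in> F \<Longrightarrow> \<psi> x \<in> K \<rightarrow> K"
      and N_le: "\<And>x a. x \<in> F \<Longrightarrow> a \<in> closure_points (\<psi> x) \<Longrightarrow> N x a \<preceq> g' a"
      using dom[of N] by blast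
    have "\<exists>h. h \<in> K \<rightarrow> K \<and> (\<forall>a\<in>K. \<phi> x a \<preceq> h a) \<and> (\<forall>a\<in>K. \<psi> x a \<preceq> h a)" if "x \<in> F" for x
      using max_fun[OF \<phi> \<psi>] that by metis
    \<comment> \<open>The pointwise maximum intersects the old club with the one on which the jumps
      are bounded.\<close>
    then obtain \<phi>' where \<phi>': "\<And>x. x \<in> F \<Longrightarrow> \<phi>' x \<in> K \<rightarrow> K"
      "\<And>x a. x \<in> F \<Longrightarrow> a \<in> K \<Longrightarrow> \<phi> x a \<preceq> \<phi>' x a" "\<And>x a. x \<in> F \<Longrightarrow> a \<in> K \<Longrightarrow> \<psi> x a \<preceq> \<phi>' x a"
      by metis
    have "closure_points (\<phi>' x) \<subseteq> closure_points (\<phi> x)" if "x \<in> F" for x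
      using closure_points_antimono \<phi>'(2) that by blast
    moreover have "\<exists>c \<in> closure_points (\<phi> x). a \<prec> c \<and> c \<preceq> g' a"
      if "x \<in> F" "a \<in> closure_points (\<phi>' x)" for x a
    proof -
      have "a \<in> closure_points (\<psi> x)"
        using closure_points_antimono \<phi>'(3) that by blast
      then show ?thesis
        using N N_le that(1) closure_points_K by blast
    qed
    ultimately have "P (Suc n) (\<phi>', g') \<and> Q n p (\<phi>', g')"
      using g' \<phi>'(1) by (simp add: P_def Q_def p)
    then show "\<exists>y. P (Suc n) y \<and> Q n p y" ..
  qed
  then obtain f where f: "\<And>n. P n (f n)" "\<And>n. Q n (f n) (f (Suc n))"
    by blast
  define \<phi> where "\<phi> n = fst (f n)" for n
  define g where "g n = snd (f n)" for n
  have f_eq: "f n = (\<phi> n, g n)" for n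
    by (simp add: \<phi>_def g_def)
  have g: "g n \<in> K \<rightarrow> K" and \<phi>: "x \<in> F \<Longrightarrow> \<phi> n x \<in> K \<rightarrow> K" for n x
    using f(1)[of n] by (auto simp: f_eq P_def)
  have H_le: "H x a \<preceq> g 0 a" if "x \<in> F" "a \<in> closure_points (\<phi> 0 x)" for x a
    using f(1)[of 0] that by (simp add: f_eq P_def)
  have decreasing: "closure_points (\<phi> (Suc n) x) \<subseteq> closure_points (\<phi> n x)" if "x \<in> F" for n x
    using f(2)[of n] that by (simp add: f_eq Q_def)
  have step: "\<exists>c \<in> closure_points (\<phi> n x). a \<prec> c \<and> c \<preceq> g (Suc n) a"
    if "x \<in> F" "a \<in> closure_points (\<phi> (Suc n) x)" for n x a
    using f(2)[of n] that by (simp add: f_eq Q_def)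
  obtain g' where g': "g' \<in> K \<rightarrow> K" "\<And>n a. a \<in> K \<Longrightarrow> g n a \<preceq> g' a"
    using countable_sup[of g] g by metis
  obtain G where G: "G \<in> K \<rightarrow> K" "\<And>a b. b \<preceq> a \<Longrightarrow> g' b \<preceq> G a"
    using running_sup[OF g'(1)] by metis
  \<comment> \<open>\<open>G\<close> is applied twice: once to reach a point \<open>c\<close> of the
    first club above \<open>a\<close>, once to bound \<open>H x c\<close>.\<close>
  define G' where "G' a = G (G a)" for a
  have close: "\<exists>c \<in> closure_points (\<phi> 0 x). a \<prec> c \<and> c \<preceq> G a"
    if x: "x \<in> F" and d: "\<And>n. d \<in> closure_points (\<phi> n x)" "d \<preceq> a" for x d a
  proof (rule ccontr)
    assume neg: "\<not> ?thesis"
    have a: "a \<in> K"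
      using d(2) le_K by blast
    have "\<exists>m. m \<in> closure_points (\<phi> n x) \<and> m \<preceq> a \<and>
        (\<forall>e. e \<in> closure_points (\<phi> n x) \<longrightarrow> e \<preceq> a \<longrightarrow> e \<preceq> m)" for n
      using greatest_closure_point_below[OF d] by metis
    then obtain m where m: "\<And>n. m n \<in> closure_points (\<phi> n x)" "\<And>n. m n \<preceq> a"
      "\<And>n e. e \<in> closure_points (\<phi> n x) \<Longrightarrow> e \<preceq> a \<Longrightarrow> e \<preceq> m n"
      by metis
    \<comment> \<open>From \<open>m (Suc n)\<close> the \<open>n\<close>-th club has a later point
      within \<open>G a\<close>. It is also in the first club, so by \<open>neg\<close> it is at
      most \<open>a\<close>, hence at most \<open>m n\<close>. The descent contradicts
      well-foundedness.\<close>
    have "m (Suc n) \<prec> m n" for n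
    proof -
      obtain c where c: "c \<in> closure_points (\<phi> n x)" "m (Suc n) \<prec> c" "c \<preceq> g (Suc n) (m (Suc n))"
        using step[OF x m(1)] by blast
      have "m (Suc n) \<in> K"
        using m(2) le_K by blast
      then have "c \<preceq> g' (m (Suc n))"
        using c(3) g'(2) le_trans by metis
      then have "c \<preceq> G a"
        using G(2)[OF m(2)] le_trans by metis
      moreover have "c \<in> closure_points (\<phi> 0 x)"
        using c(1) decreasing[OF x] by (induction n) blast+
      ultimately have "c \<preceq> a"
        using neg not_le[of c a] a closure_points_K by blast
      then have "c \<preceq> m n"
        using m(3) c(1) by blast
      then show ?thesis
        using c(2) lt_le_trans by blast
    qed
    then show False
      using no_descending by blast
  qed
  have "leq_star r x (restrict G' K)" if x: "x \<in> F" for x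
  proof -
    \<comment> \<open>Closure points of \<open>\<psi>\<close> lie in all clubs of \<open>x\<close>
      at once. One such \<open>d\<close> is the threshold from which \<open>G'\<close> bounds
      \<open>x\<close>.\<close>
    obtain \<psi> where \<psi>: "\<psi> \<in> K \<rightarrow> K" "\<And>n a. a \<in> K \<Longrightarrow> \<phi> n x a \<preceq> \<psi> a"
      using countable_sup[of "\<lambda>n. \<phi> n x"] \<phi>[OF x] by metis
    obtain a0 where "a0 \<in> K"
      using infinite_K by (metis ex_in_conv finite.emptyI)
    then obtain d where "d \<in> closure_points \<psi>"
      using closure_points_unbounded[OF \<psi>(1)] by metis
    then have d: "d \<in> closure_points (\<phi> n x)" for n
      using closure_points_antimono[of "\<phi> n x" \<psi>] \<psi>(2) by blast
    have "x a \<preceq> G' a" if a: "d \<preceq> a" for a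
    proof -
      obtain c where c: "c \<in> closure_points (\<phi> 0 x)" "a \<prec> c" "c \<preceq> G a"
        using close[OF x d a] by blast
      have "x a \<preceq> H x c"
        using H(2)[OF x] c(2) lt_imp_le by blast
      then have "x a \<preceq> g 0 c"
        using H_le[OF x c(1)] le_trans by blast
      then show ?thesis
        using g'(2)[of c 0] G(2)[OF c(3)] le_trans le_K[OF c(3)] unfolding G'_def by metis
    qed
    then have "{a \<in> K. (restrict G' K a, x a) \<in> r \<and> restrict G' K a \<noteq> x a} \<subseteq> {a. a \<prec> d}"
    proof (intro subsetI CollectI)
      fix a
      assume x_le: "\<And>a. d \<preceq> a \<Longrightarrow> x a \<preceq> G' a"
        and a: "a \<in> {a \<in> K. restrict G' K a \<preceq> x a \<and> restrict G' K a \<noteq> x a}"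
      then have "\<not> d \<preceq> a"
        using le_antisym[of "G' a" "x a"] by auto
      moreover have "d \<in> K"
        using d[of 0] closure_points_K by blast
      ultimately show "a \<prec> d"
        using not_le a by simp
    qed
    from small_subset[OF small_below this] show ?thesis
      unfolding leq_star_def .
  qed
  \<comment> \<open>Members of \<open>kfun r\<close> are extensional, so the bound is restricted to
    \<open>K\<close>.\<close>
  moreover have "restrict G' K \<in> kfun r"
    using G(1) by (simp add: kfun_def G'_def Pi_iff)
  ultimately show False
    using F unfolding unbounded_family_def by blast
qed

section \<open>The lower bound for mad families\<close>

lemma small_or_full:
  assumes "A \<subseteq> K"
  shows "|A| =o r \<longleftrightarrow> \<not> |A| <o r"
proof -
  have "|A| \<le>o r"
    using card_of_mono1[OF assms] card_K ordLeq_ordIso_trans by blast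
  then show ?thesis
    using ordLeq_iff_ordLess_or_ordIso not_ordLess_ordIso by blast
qed

lemma card_inj_image:
  assumes "inj_on f K"
  shows "|f ` K| =o r"
proof -
  have "|K| =o |f ` K|"
    using assms card_of_ordIso by (blast intro: inj_on_imp_bij_betw)
  then show ?thesis
    using card_K ordIso_symmetric ordIso_transitive by blast
qed

lemma kappa_subsets_iff: "A \<in> kappa_subsets r \<longleftrightarrow> A \<subseteq> K \<and> \<not> |A| <o r"
  using small_or_full by (auto simp: kappa_subsets_def)

text \<open>Diagonalisation: if the family had size \<kappa>, enumerate it as \<open>a i\<close> and
  pick \<open>b i\<close> in \<open>a i\<close> outside all earlier sets. The set of all
  \<open>b i\<close> has size \<kappa> and meets \<open>a i\<close> only in points
  \<open>b j\<close> with \<open>j \<preceq> i\<close>.\<close>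

lemma mad_family_ge_cardSuc:
  assumes mad: "mad_family r \<A>"
  shows "cardSuc r \<le>o |\<A>|"
proof (rule ccontr)
  assume "\<not> cardSuc r \<le>o |\<A>|"
  then have "\<not> r <o |\<A>|"
    using cardSuc_ordLess_ordLeq[OF card card_of_Card_order] by blast
  moreover have "r \<le>o |\<A>|"
    using mad by (simp add: mad_family_def)
  ultimately have "r =o |\<A>|"
    using ordLeq_iff_ordLess_or_ordIso by blast
  then have "|K| =o |\<A>|"
    using card_K ordIso_transitive by blast
  then obtain a where a: "bij_betw a K \<A>"
    using card_of_ordIso by blast
  have a_mem: "a i \<in> \<A>" if "i \<in> K" for i
    using a that bij_betwE by blast
  have a_kappa: "a i \<subseteq> K" "\<not> |a i| <o r" if "i \<in> K" for i
    using mad a_mem[OF that] kappa_subsets_iff by (auto simp: mad_family_def)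
  have a_ad: "|a i \<inter> a j| <o r" if "i \<in> K" "j \<prec> i" for i j
  proof -
    have "a i \<noteq> a j"
      using inj_on_eq_iff[OF bij_betw_imp_inj_on[OF a]] that lt_K[OF that(2)] by (auto simp: lt_def)
    then show ?thesis
      using mad a_mem that lt_K by (auto simp: mad_family_def almost_disjoint_def)
  qed
  \<comment> \<open>Otherwise \<open>a i\<close> would be a union of fewer than \<kappa> small
    intersections, hence small by regularity.\<close>
  have "\<exists>c. c \<in> a i - (\<Union>j\<in>{j. j \<prec> i}. a j)" if i: "i \<in> K" for i
  proof (rule ccontr)
    assume "\<not> ?thesis"
    then have "a i \<subseteq> (\<Union>j\<in>{j. j \<prec> i}. a i \<inter> a j)"
      by blast
    moreover have "|\<Union>j\<in>{j. j \<prec> i}. a i \<inter> a j| <o r"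
      using a_ad[OF i] by (intro small_UN small_below) simp
    ultimately show False
      using a_kappa(2)[OF i] small_subset by blast
  qed
  then obtain b where b: "\<And>i. i \<in> K \<Longrightarrow> b i \<in> a i" "\<And>i j. i \<in> K \<Longrightarrow> j \<prec> i \<Longrightarrow> b i \<notin> a j"
    by (metis DiffD1 DiffD2 UN_I mem_Collect_eq)
  have "inj_on b K"
  proof (rule inj_onI, rule ccontr)
    fix i j
    assume ij: "i \<in> K" "j \<in> K" "b i = b j" "i \<noteq> j"
    then have "i \<prec> j \<or> j \<prec> i"
      using not_le by (auto simp: lt_def)
    then show False
      using b ij(1,2,3) by metis
  qed
  then have "|b ` K| =o r"
    by (rule card_inj_image)
  moreover have "b ` K \<subseteq> K"
    using b(1) a_kappa(1) by blast
  ultimately have "b ` K \<in> kappa_subsets r"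
    by (simp add: kappa_subsets_def)
  moreover have "almost_disjoint r (b ` K) A" if A: "A \<in> \<A>" for A
  proof -
    obtain i where i: "i \<in> K" "A = a i"
      using A bij_betw_imp_surj_on[OF a] by blast
    have "b ` K \<inter> A \<subseteq> b ` {j. j \<preceq> i}"
      using b(2) i not_le by blast
    moreover have "|b ` {j. j \<preceq> i}| <o r"
      using small_below_eq card_of_image ordLeq_ordLess_trans by blast
    ultimately show ?thesis
      using small_subset unfolding almost_disjoint_def by blast
  qed
  ultimately show False
    using mad by (auto simp: mad_family_def)
qed

section \<open>Construction of a mad family of size at most \<open>cardSuc r\<close>\<close>

text \<open>Repetitions are allowed, so any nonempty \<open>P\<close> of size at most \<kappa> can
  be enumerated; for other \<open>P\<close> the value is arbitrary.\<close>

definition enum :: "'a set set \<Rightarrow> 'a \<Rightarrow> 'a set" where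
  "enum P = (SOME e. e ` K = P)"

text \<open>Each set of \<open>P\<close> is removed from all but boundedly many of the intervals \<open>[a, f a)\<close>.\<close>

definition diag :: "'a set set \<Rightarrow> ('a \<Rightarrow> 'a) \<Rightarrow> 'a set" where
  "diag P f = {c \<in> K. \<exists>a. a \<preceq> c \<and> c \<prec> f a \<and> (\<forall>i. i \<prec> a \<longrightarrow> c \<notin> enum P i)}"

lemma enum_image:
  assumes "P \<noteq> {}" "|P| \<le>o r"
  shows "enum P ` K = P"
proof -
  have "|P| \<le>o |K|"
    using assms(2) card_K ordIso_symmetric ordLeq_ordIso_trans by blast
  then have "\<exists>e. e ` K = P"
    using card_of_ordLeq2[OF assms(1)] by blast
  then show ?thesis
    unfolding enum_def by (rule someI_ex)
qed

text \<open>If \<open>X\<close> is \<open>enum P i\<close>, a point of \<open>X\<close> can enter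
  only through an interval starting at some \<open>a \<preceq> i\<close>. These are fewer than
  \<kappa> intervals, each bounded by \<open>f a\<close>.\<close>

lemma diag_almost_disjoint:
  assumes "|P| \<le>o r" "X \<in> P"
  shows "|diag P f \<inter> X| <o r"
proof -
  have "X \<in> enum P ` K"
    using enum_image assms by blast
  then obtain i where i: "i \<in> K" "X = enum P i"
    by blast
  have "diag P f \<inter> X \<subseteq> (\<Union>a\<in>{a. a \<preceq> i}. {c. c \<prec> f a})"
    using i not_le le_K by (auto simp: diag_def) blast
  moreover have "|\<Union>a\<in>{a. a \<preceq> i}. {c. c \<prec> f a}| <o r"
    by (intro small_UN small_below small_below_eq)
  ultimately show ?thesis
    using small_subset by blast
qed

text \<open>The images of the columns under a bijection from \<kappa> \<times> \<kappa> to \<kappa>.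
  They will give the mad family its \<kappa> members.\<close>

lemma kappa_partition:
  obtains p where "\<And>i. i \<in> K \<Longrightarrow> p i \<subseteq> K" "\<And>i. i \<in> K \<Longrightarrow> \<not> |p i| <o r"
    "\<And>i j. i \<in> K \<Longrightarrow> j \<in> K \<Longrightarrow> i \<noteq> j \<Longrightarrow> p i \<inter> p j = {}"
proof -
  have "|K \<times> K| =o |K|"
    by (rule card_of_Times_same_infinite[OF infinite_K])
  then obtain h where h: "bij_betw h (K \<times> K) K"
    using card_of_ordIso by blast
  then have inj: "inj_on h (K \<times> K)"
    by (rule bij_betw_imp_inj_on)
  define p where "p i = h ` ({i} \<times> K)" for i
  show ?thesis
  proof (rule that[of p])
    fix i
    assume i: "i \<in> K"
    show "p i \<subseteq> K"
      using h i bij_betwE by (fastforce simp: p_def)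
    have "inj_on (\<lambda>j. h (i, j)) K"
      using inj i by (auto simp: inj_on_def)
    moreover have "p i = (\<lambda>j. h (i, j)) ` K"
      by (auto simp: p_def)
    ultimately have "|p i| =o r"
      using card_inj_image by simp
    then show "\<not> |p i| <o r"
      using not_ordLess_ordIso by blast
  next
    fix i j
    assume "i \<in> K" "j \<in> K" "i \<noteq> j"
    then show "p i \<inter> p j = {}"
      using inj by (auto simp: p_def inj_on_def)
  qed
qed

text \<open>Well-order \<open>F\<close> by its cardinal order: proper initial segments then have
  size at most \<kappa>, so at stage \<open>x\<close> all earlier sets can be enumerated along
  \<kappa> and diagonalised against.\<close>

lemma ex_mad_family:
  assumes F: "unbounded_family r F" and F_card: "|F| =o cardSuc r"
  shows "\<exists>\<A>. mad_family r \<A> \<and> |\<A>| \<le>o cardSuc r"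
proof -
  obtain \<Phi> where \<Phi>: "\<And>x. x \<in> F \<Longrightarrow> \<Phi> x \<in> K \<rightarrow> K"
    "\<And>g. g \<in> K \<rightarrow> K \<Longrightarrow> \<exists>x\<in>F. \<forall>\<phi> \<in> K \<rightarrow> K. \<exists>a \<in> closure_points \<phi>. g a \<prec> \<Phi> x a"
    using stationary_family[OF F] by blast
  obtain p where p: "\<And>i. i \<in> K \<Longrightarrow> p i \<subseteq> K" "\<And>i. i \<in> K \<Longrightarrow> \<not> |p i| <o r"
    "\<And>i j. i \<in> K \<Longrightarrow> j \<in> K \<Longrightarrow> i \<noteq> j \<Longrightarrow> p i \<inter> p j = {}"
    using kappa_partition by blast
  define R where "R = |F| - Id"
  have wo_F: "wo_rel |F|"
    using card_of_Well_order by (simp add: wo_rel_def)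
  define T where "T = wfrec R (\<lambda>A x. diag (p ` K \<union> A ` underS |F| x) (\<Phi> x))"
  define P where "P x = p ` K \<union> T ` underS |F| x" for x
  \<comment> \<open>The recursion consults only predecessors of \<open>x\<close>, where
    \<open>cut\<close> changes nothing.\<close>
  have T_eq: "T x = diag (P x) (\<Phi> x)" for x
  proof -
    have "cut T R x y = T y" if "y \<in> underS |F| x" for y
      using that by (auto simp: cut_def R_def underS_def)
    then have "cut T R x ` underS |F| x = T ` underS |F| x"
      by (intro image_cong) simp_all
    moreover have "wf R"
      using wo_rel.WF[OF wo_F] by (simp add: R_def)
    ultimately show ?thesis
      unfolding P_def by (subst T_def, subst wfrec) (simp_all add: T_def)
  qed
  have T_K: "T x \<subseteq> K" for x
    by (auto simp: T_eq diag_def)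
  have pK_card: "|p ` K| \<le>o r"
    using card_of_image card_K ordLeq_ordIso_trans by blast
  have P_card: "|P x| \<le>o r" if "x \<in> F" for x
  proof -
    have "|underS |F| x| <o |F|"
      using card_of_underS[OF card_of_Card_order] that by (simp add: Field_card_of)
    then have "|underS |F| x| <o cardSuc r"
      using F_card ordLess_ordIso_trans by blast
    then have "|underS |F| x| \<le>o r"
      using cardSuc_ordLeq_ordLess[OF card card_of_Card_order] by blast
    then have "|T ` underS |F| x| \<le>o r"
      using card_of_image ordLeq_transitive by blast
    then show ?thesis
      unfolding P_def by (intro card_of_Un_ordLeq_infinite_Field infinite_K pK_card card)
  qed
  \<comment> \<open>Some \<open>T x\<close> may be small. Dropping them is harmless for maximality,
    since they meet every set in a small set.\<close>
  define \<A> where "\<A> = p ` K \<union> {A \<in> T ` F. \<not> |A| <o r}"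
  have ad_p: "|T x \<inter> p i| <o r" if "x \<in> F" "i \<in> K" for x i
  proof -
    have "p i \<in> P x"
      using that by (simp add: P_def)
    then show ?thesis
      using diag_almost_disjoint[OF P_card[OF that(1)]] by (simp add: T_eq[of x])
  qed
  have ad_less: "|T x \<inter> T y| <o r" if "x \<in> F" "y \<in> underS |F| x" for x y
  proof -
    have "T y \<in> P x"
      using that by (simp add: P_def)
    then show ?thesis
      using diag_almost_disjoint[OF P_card[OF that(1)], of "T y" "\<Phi> x"] T_eq[of x] by simp
  qed
  have ad_T: "|T x \<inter> T y| <o r" if "x \<in> F" "y \<in> F" "x \<noteq> y" for x y
  proof -
    have "y \<in> underS |F| x \<or> x \<in> underS |F| y"
      using wo_rel.TOTALS[OF wo_F] that by (auto simp: underS_def Field_card_of)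
    then show ?thesis
      using ad_less that by (metis Int_commute)
  qed
  have "\<A> \<subseteq> kappa_subsets r"
    using p(1,2) T_K by (auto simp: \<A>_def kappa_subsets_iff)
  moreover have "almost_disjoint r A B" if "A \<in> \<A>" "B \<in> \<A>" "A \<noteq> B" for A B
  proof -
    have AB: "A \<in> p ` K \<or> A \<in> T ` F" "B \<in> p ` K \<or> B \<in> T ` F"
      using that by (auto simp: \<A>_def)
    have "|A \<inter> B| <o r" if "A \<in> p ` K" "B \<in> p ` K"
    proof -
      have "A \<inter> B = {}"
        using that \<open>A \<noteq> B\<close> p(3) by blast
      then show ?thesis
        by (simp add: small_finite)
    qed
    moreover have "|A \<inter> B| <o r" if "A \<in> T ` F" "B \<in> p ` K"
      using that ad_p by blast
    moreover have "|A \<inter> B| <o r" if "A \<in> p ` K" "B \<in> T ` F"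
      using that ad_p by (metis Int_commute imageE)
    moreover have "|A \<inter> B| <o r" if "A \<in> T ` F" "B \<in> T ` F"
      using that \<open>A \<noteq> B\<close> ad_T by blast
    ultimately show ?thesis
      using AB unfolding almost_disjoint_def by blast
  qed
  moreover have "r \<le>o |\<A>|"
  proof -
    have "p i \<noteq> p j" if "i \<in> K" "j \<in> K" "i \<noteq> j" for i j
    proof
      assume "p i = p j"
      then have "p i = {}"
        using p(3)[OF that] by simp
      then show False
        using p(2)[OF that(1)] by (simp add: small_finite)
    qed
    then have "inj_on p K"
      by (meson inj_onI)
    moreover have "p ` K \<subseteq> \<A>"
      by (auto simp: \<A>_def)
    ultimately have "|K| \<le>o |\<A>|"
      using card_of_ordLeq by blast
    then show ?thesis
      using card_K ordIso_symmetric ordIso_ordLeq_trans by blast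
  qed
  moreover have "\<not> (\<exists>B \<in> kappa_subsets r. \<forall>A \<in> \<A>. almost_disjoint r B A)"
  proof
    assume "\<exists>B \<in> kappa_subsets r. \<forall>A \<in> \<A>. almost_disjoint r B A"
    then obtain B where "B \<in> kappa_subsets r" and ad: "\<And>A. A \<in> \<A> \<Longrightarrow> |B \<inter> A| <o r"
      unfolding almost_disjoint_def by auto
    then have B: "B \<subseteq> K" "\<not> |B| <o r"
      by (simp_all add: kappa_subsets_iff)
    have small: "|B \<inter> X| <o r" if "X \<in> p ` K \<union> T ` F" for X
    proof (cases "X \<in> \<A>")
      case True
      then show ?thesis
        by (rule ad)
    next
      case False
      then have "|X| <o r"
        using that by (auto simp: \<A>_def)
      then show ?thesis
        using small_subset by blast
    qed
    have "\<exists>b. b \<in> B \<and> a \<prec> b" if "a \<in> K" for a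
      using large_unbounded[OF B that] by blast
    then obtain g where g: "\<And>a. a \<in> K \<Longrightarrow> g a \<in> B" "\<And>a. a \<in> K \<Longrightarrow> a \<prec> g a"
      by metis
    then have "g \<in> K \<rightarrow> K"
      using B(1) by blast
    \<comment> \<open>\<open>g\<close> picks a point of \<open>B\<close> above each
      \<open>a\<close>; for this \<open>x\<close>, stationarily many intervals from \<open>a\<close>
      to \<open>\<Phi> x a\<close> contain that point.\<close>
    then obtain x where x: "x \<in> F" "\<And>\<phi>. \<phi> \<in> K \<rightarrow> K \<Longrightarrow> \<exists>a \<in> closure_points \<phi>. g a \<prec> \<Phi> x a"
      using \<Phi>(2) by blast
    have bounded: "\<exists>b. b \<in> K \<and> (\<forall>c \<in> B \<inter> X. c \<preceq> b)" if "X \<in> p ` K \<union> T ` F" for X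
    proof -
      have "B \<inter> X \<subseteq> K"
        using B(1) by blast
      from small_bounded[OF this small[OF that]]
      obtain b where "b \<in> K" "\<And>c. c \<in> B \<inter> X \<Longrightarrow> c \<preceq> b"
        by blast
      then show ?thesis
        by auto
    qed
    have P_sub: "P x \<subseteq> p ` K \<union> T ` F"
      using x(1) using Order_Relation.underS_Field[of "|F|" x] by (auto simp: P_def Field_card_of)
    have "K \<noteq> {}"
      using infinite_K by auto
    then have enum_P: "enum (P x) ` K = P x"
      by (intro enum_image P_card x(1)) (simp add: P_def)
    have "\<exists>b. b \<in> K \<and> (\<forall>c \<in> B \<inter> enum (P x) i. c \<preceq> b)" if "i \<in> K" for i
    proof -
      have "enum (P x) i \<in> P x"
        using enum_P that by blast
      then show ?thesis
        using bounded P_sub by (meson subsetD)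
    qed
    then obtain \<psi> where \<psi>: "\<And>i. i \<in> K \<Longrightarrow> \<psi> i \<in> K"
      "\<And>i c. i \<in> K \<Longrightarrow> c \<in> B \<inter> enum (P x) i \<Longrightarrow> c \<preceq> \<psi> i"
      by metis
    obtain \<beta> where \<beta>: "\<beta> \<in> K" "\<And>c. c \<in> B \<inter> T x \<Longrightarrow> c \<preceq> \<beta>"
      using bounded[of "T x"] x(1) by blast
    have "\<psi> \<in> K \<rightarrow> K" "(\<lambda>_. \<beta>) \<in> K \<rightarrow> K"
      using \<psi>(1) \<beta>(1) by blast+
    \<comment> \<open>A closure point \<open>a\<close> of \<open>\<phi>\<close> exceeds the bound of
      \<open>B\<close> on each of the first \<open>a\<close> sets of the enumeration, and also the
      bound \<open>\<beta>\<close> on \<open>T x\<close>.\<close>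
    from max_fun[OF this] obtain \<phi> where \<phi>: "\<phi> \<in> K \<rightarrow> K"
      "\<And>a. a \<in> K \<Longrightarrow> \<psi> a \<preceq> \<phi> a" "\<And>a. a \<in> K \<Longrightarrow> \<beta> \<preceq> \<phi> a"
      by blast
    obtain a where a: "a \<in> closure_points \<phi>" "g a \<prec> \<Phi> x a"
      using x(2)[OF \<phi>(1)] by blast
    have aK: "a \<in> K"
      using a(1) closure_points_K by blast
    have below: "\<phi> i \<prec> a" if "i \<prec> a" for i
      using a(1) that by (simp add: closure_points_def)
    \<comment> \<open>That \<open>a\<close> is nonzero is needed here: \<beta> is compared with
      \<open>a\<close> through \<open>\<phi> j\<close> for some \<open>j\<close> below
      \<open>a\<close>.\<close>
    obtain j where j: "j \<prec> a"
      using a(1) by (auto simp: closure_points_def)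
    have "\<not> g a \<preceq> \<beta>"
    proof
      assume "g a \<preceq> \<beta>"
      then have "g a \<preceq> \<phi> j"
        using \<phi>(3) j lt_K le_trans by metis
      then show False
        using le_lt_trans[OF _ below[OF j]] lt_asym[OF g(2)[OF aK]] by metis
    qed
    then have "g a \<notin> T x"
      using \<beta>(2) g(1)[OF aK] by blast
    moreover have "g a \<in> K" "a \<preceq> g a"
      using g(2)[OF aK] lt_K lt_imp_le by blast+
    \<comment> \<open>\<open>g a\<close> lies in the interval but not in \<open>T x\<close>, so it
      was removed as a member of one of the first \<open>a\<close> sets. There \<open>B\<close> is
      bounded by \<open>\<psi> i\<close>, which is below \<open>a\<close>, against the choice of
      \<open>g a\<close> above \<open>a\<close>.\<close>
    ultimately obtain i where i: "i \<prec> a" "g a \<in> enum (P x) i"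
      using a(2) by (auto simp: T_eq diag_def)
    have "i \<in> K"
      using i(1) lt_K by simp
    then have "g a \<preceq> \<psi> i"
      using \<psi>(2) i(2) g(1)[OF aK] by simp
    then have "g a \<preceq> \<phi> i"
      using \<phi>(2)[OF \<open>i \<in> K\<close>] le_trans by metis
    then show False
      using le_lt_trans[OF _ below[OF i(1)]] lt_asym[OF g(2)[OF aK]] by metis
  qed
  ultimately have "mad_family r \<A>"
    by (simp add: mad_family_def)
  moreover have "|\<A>| \<le>o cardSuc r"
  proof -
    have "|p ` K| \<le>o cardSuc r"
      using pK_card cardSuc_ordLeq[OF card] ordLeq_transitive by blast
    moreover have "|T ` F| \<le>o cardSuc r"
      using card_of_image F_card ordLeq_ordIso_trans by blast
    ultimately have "|p ` K \<union> T ` F| \<le>o cardSuc r"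
      using cardSuc_finite[OF card] infinite_K cardSuc_Card_order[OF card]
      by (intro card_of_Un_ordLeq_infinite_Field) simp_all
    moreover have "\<A> \<subseteq> p ` K \<union> T ` F"
      by (auto simp: \<A>_def)
    ultimately show ?thesis
      using card_of_mono1[of \<A> "p ` K \<union> T ` F"] ordLeq_transitive by blast
  qed
  ultimately show ?thesis
    by blast
qed

end

theorem theorem2p2:
  fixes r :: "'a rel"
  assumes "Card_order r"
    and "natLeq <o r"
    and "regularCard r"
    and "bounding_number_is r (cardSuc r)"
  shows "almost_disjointness_number_is r (cardSuc r)"
proof -
  interpret regular_uncountable r
    using assms(1-3) by unfold_locales
  obtain F where "unbounded_family r F" "|F| =o cardSuc r"
    using assms(4) by (auto simp: bounding_number_is_def)
  then obtain \<A> where \<A>: "mad_family r \<A>" "|\<A>| \<le>o cardSuc r"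
    using ex_mad_family by blast
  then have "|\<A>| =o cardSuc r"
    using mad_family_ge_cardSuc ordIso_iff_ordLeq by blast
  then show ?thesis
    using \<A>(1) mad_family_ge_cardSuc unfolding almost_disjointness_number_is_def by blast
qed

end
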